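(* Let $E$ be a closed subset of $\overline{\mathbb D}$ with at least two points. Then $E$ is $t$-analytic for the disk-algebra $A(\overline{\mathbb D})$ if and only if $E$ does not contain any isolated points and for every open arc $I\subseteq \mathbb T$ that does not meet $\overline{E\cap \mathbb D}$ one has either $I\cap E=\emptyset$ or $\sigma(I\cap E)>0$.
   Context: $\mathbb D$ is the open unit disk in $\mathbb C$, $\mathbb T$ its boundary circle, and $\sigma$ is normalized Lebesgue measure on $\mathbb T$. The disk-algebra $A(\overline{\mathbb D})$ is the algebra of continuous functions on $\overline{\mathbb D}$ that are analytic in $\mathbb D$, with the supremum norm; its character space is identified with $\overline{\mathbb D}$. Isolated points of $E$ are meant with respect to the relative topology of $E$. A set $E\subseteq \overline{\mathbb D}$ is $t$-analytic for $A(\overline{\mathbb D})$ if for every $f\in A(\overline{\mathbb D})$ and every non-empty relatively open subset $U$ of $E$, $f\equiv 0$ on $U$ implies $f\equiv 0$ on $E$. *)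

theory Defs
  imports "HOL-Analysis.Analysis"
begin

definition disk_algebra :: "(complex \<Rightarrow> complex) set" where
  "disk_algebra = {f. continuous_on (cball 0 1) f \<and> f holomorphic_on ball 0 1}"

definition t_analytic :: "('a::topological_space \<Rightarrow> complex) set \<Rightarrow> 'a set \<Rightarrow> bool" where
  "t_analytic A E \<longleftrightarrow>
     (\<forall>f\<in>A. \<forall>U. openin (top_of_set E) U \<and> U \<noteq> {} \<and> (\<forall>x\<in>U. f x = 0) \<longrightarrow> (\<forall>x\<in>E. f x = 0))"

text \<open>Normalized Lebesgue measure on the unit circle, as a Borel measure on the plane.\<close>

definition circle_measure :: "complex measure" where
  "circle_measure = distr (uniform_measure lborel {0..2 * pi}) borel cis"

text \<open>Here \<open>b = a + 2 * pi\<close>, the circle minus one point, is allowed; the full circle is not an arc.\<close>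

definition open_arc :: "complex set \<Rightarrow> bool" where
  "open_arc I \<longleftrightarrow> (\<exists>a b. a < b \<and> b \<le> a + 2 * pi \<and> I = cis ` {a<..<b})"

end

theory Submission
  imports Defs "HOL-Complex_Analysis.Complex_Analysis"
begin

text \<open>If \<open>E\<close> has points in the disk near the zeros, the identity theorem decides; otherwise everything
  happens on the circle, and two facts about boundary zeros of a disk algebra function are needed.

  Uniqueness: a zero set of positive measure on the circle forces \<open>f = 0\<close>. If \<open>u\<close> is continuous and
  \<open>\<bar>f\<bar> \<le> exp u\<close> on the circle, then approximating \<open>u\<close> by real parts of polynomials \<open>P\<close> and applying the
  maximum principle to \<open>f * exp (- P)\<close> bounds \<open>ln \<bar>f 0\<bar>\<close> by the mean of \<open>u\<close>, which can be made
  arbitrarily negative.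

  Fatou: a closed null set \<open>K\<close> of the circle is a zero set. Cover \<open>K\<close> by finitely many disks
  with centres \<open>c\<close> in \<open>K\<close> and radii \<open>r\<close> of small total size. The rational function
  \<open>r / (1 + r - z * cnj c)\<close> has nonnegative real part in the closed disk, real part at least \<open>1/4\<close> within
  \<open>r\<close> of \<open>c\<close>, and modulus at most \<open>r / dist z c\<close>. Summing over infinitely many finer and finer covers
  gives \<open>S\<close> with \<open>Re S \<rightarrow> \<infinity>\<close> exactly at \<open>K\<close>, and \<open>exp (- S)\<close> is the required function.\<close>

section \<open>Fatou's theorem: closed null sets of the circle as zero sets\<close>

text \<open>Outer regularity puts \<open>N\<close> in an open \<open>T\<close> of measure below
  \<open>e/5\<close>. Vitali selects disjoint intervals inside \<open>T\<close> whose fivefold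
  enlargements still cover \<open>N\<close>, and compactness leaves finitely many. The centres must
  lie in \<open>N\<close>, because later estimates use only the distance to
  \<open>K\<close>.\<close>

lemma compact_null_set_cover:
  fixes N :: "real set"
  assumes "compact N" "N \<in> null_sets lborel" "0 < e"
  obtains C r where "finite C" "C \<subseteq> N" "\<And>c. c \<in> C \<Longrightarrow> 0 < r c"
    "N \<subseteq> (\<Union>c\<in>C. ball c (r c))" "(\<Sum>c\<in>C. r c) < e"
proof -
  have neg: "N \<in> null_sets lebesgue"
    using assms(2) by (simp add: null_sets_completionI)
  then have N: "N \<in> sets lebesgue" by auto
  have "e / 5 > 0" using assms by simp
  from sets_lebesgue_outer_open[OF N this]
  obtain T where T: "open T" "N \<subseteq> T" "T - N \<in> lmeasurable" "emeasure lebesgue (T - N) < ennreal (e/5)"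
    by blast
  have Tm: "emeasure lebesgue T < ennreal (e/5)"
  proof -
    have "emeasure lebesgue T = emeasure lebesgue (T - N)"
      by (rule emeasure_Diff_null_set[symmetric]) (use neg T(1) in \<open>auto intro: borel_open sets_completionI_sets\<close>)
    then show ?thesis using T by simp
  qed
  \<comment> \<open>Capping the radii by 1 provides the uniform bound that the covering lemma asks
    for.\<close>
  have "\<exists>r. 0 < r \<and> r \<le> 1 \<and> cball t r \<subseteq> T" if t: "t \<in> N" for t
  proof -
    obtain s where s: "s > 0" "cball t s \<subseteq> T"
      using open_contains_cball[THEN iffD1, OF T(1)] T(2) t by blast
    show ?thesis
      by (rule exI[of _ "min s 1"]) (use s subset_cball[of "min s 1" s t] in auto)
  qed
  then obtain r where r: "\<And>t. t \<in> N \<Longrightarrow> 0 < r t \<and> r t \<le> 1" "\<And>t. t \<in> N \<Longrightarrow> cball t (r t) \<subseteq> T"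
    by metis
  obtain C where C: "countable C" "C \<subseteq> N"
     "pairwise (\<lambda>i j. disjnt (cball i (r i)) (cball j (r j))) C"
     "\<And>i. i \<in> N \<Longrightarrow> \<exists>j. j \<in> C \<and> \<not> disjnt (cball i (r i)) (cball j (r j)) \<and> cball i (r i) \<subseteq> ball j (5 * r j)"
    by (rule Vitali_covering_lemma_cballs_balls[of N r 1 "\<lambda>x. x"]) (use r(1) in blast)+
  have "N \<subseteq> (\<Union>c\<in>C. ball c (5 * r c))"
  proof
    fix t assume "t \<in> N"
    moreover from this obtain j where "j \<in> C" "cball t (r t) \<subseteq> ball j (5 * r j)" using C(4) by blast
    moreover have "t \<in> cball t (r t)" using r(1)[OF \<open>t \<in> N\<close>] by simp
    ultimately show "t \<in> (\<Union>c\<in>C. ball c (5 * r c))" by blast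
  qed
  then obtain D where D: "D \<subseteq> C" "finite D" "N \<subseteq> (\<Union>c\<in>D. ball c (5 * r c))"
    by (rule compactE_image[OF assms(1) open_ball])
  have pos: "0 < r c" if "c \<in> D" for c using that D C r by blast
  have "(\<Sum>c\<in>D. ennreal (2 * r c)) = (\<Sum>c\<in>D. emeasure lebesgue (cball c (r c)))"
    by (rule sum.cong) (simp_all add: cball_eq_atLeastAtMost less_imp_le[OF pos])
  also have "\<dots> = emeasure lebesgue (\<Union>c\<in>D. cball c (r c))"
  proof (rule sum_emeasure)
    show "disjoint_family_on (\<lambda>c. cball c (r c)) D"
      using C(3) D(1) unfolding disjoint_family_on_def pairwise_def disjnt_def by blast
  qed (use D in auto)
  also have "\<dots> \<le> emeasure lebesgue T"
    by (rule emeasure_mono) (use T(1) D C(2) r(2) in \<open>blast intro: borel_open sets_completionI_sets | simp add: borel_open\<close>)+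
  also have "\<dots> < ennreal (e/5)" by (rule Tm)
  finally have "ennreal (\<Sum>c\<in>D. 2 * r c) < ennreal (e/5)"
    using pos by (subst (asm) sum_ennreal) (auto intro: less_imp_le)
  moreover have "0 \<le> (\<Sum>c\<in>D. 2 * r c)" using pos by (intro sum_nonneg) (simp add: less_imp_le)
  ultimately have "(\<Sum>c\<in>D. 2 * r c) < e/5" by (simp only: ennreal_less_iff)
  then have "(\<Sum>c\<in>D. 5 * r c) < e"
    using \<open>e > 0\<close> by (simp flip: sum_distrib_left)
  then show ?thesis
    by (intro that[of D "\<lambda>c. 5 * r c"]) (use D C(2) pos in auto)
qed

text \<open>The pole \<open>(1 + r) * c\<close> lies just outside the disk. With
  \<open>w = 1 - z * cnj c\<close>, of modulus \<open>dist z c\<close> and nonnegative real part,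
  the denominator is \<open>q = r + w\<close>. Hence \<open>Re q \<ge> r\<close> and
  \<open>norm q \<ge> norm w\<close>. Within \<open>r\<close> of \<open>c\<close> also
  \<open>norm q \<le> 2 * r\<close>, so \<open>Re g = r * Re q / (norm q)\<^sup>2\<close> is at
  least \<open>1/4\<close>.\<close>

lemma peak_term:
  fixes z c :: complex
  assumes c: "norm c = 1" and z: "norm z \<le> 1" and r: "0 < r"
  defines "g \<equiv> of_real r / (1 + of_real r - z * cnj c)"
  shows "1 + of_real r - z * cnj c \<noteq> 0" "0 \<le> Re g" "dist z c < r \<Longrightarrow> 1/4 \<le> Re g"
    "norm g * dist z c \<le> r"
proof -
  define w where "w = 1 - z * cnj c"
  define q where "q = of_real r + w"
  have qeq: "1 + of_real r - z * cnj c = q" by (simp add: q_def w_def)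
  have "norm (z * cnj c) \<le> 1" using c z by (simp add: norm_mult)
  then have w0: "0 \<le> Re w" 
    using complex_Re_le_cmod[of "z * cnj c"] by (simp add: w_def)
  then have req: "r \<le> Re q" by (simp add: q_def)
  then show q0: "1 + of_real r - z * cnj c \<noteq> 0" using r qeq by fastforce
  have cc: "c * cnj c = 1" using c by (metis complex_norm_square of_real_1 power_one)
  then have "w = (c - z) * cnj c" by (simp add: w_def algebra_simps)
  then have nw: "norm w = dist z c" using c by (simp add: norm_mult dist_norm norm_minus_commute)
  have "(norm w)\<^sup>2 \<le> (norm q)\<^sup>2"
    using w0 r unfolding cmod_power2 q_def by (simp add: power2_eq_square algebra_simps)
  then have wq: "norm w \<le> norm q" by (rule power2_le_imp_le) simp
  have qpos: "norm q > 0" using q0 qeq by simp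
  have g: "g = of_real r / q" by (simp add: g_def qeq)
  have Reg: "Re g = r * Re q / (norm q)\<^sup>2"
    unfolding g by (simp add: Re_divide cmod_power2)
  show "0 \<le> Re g" unfolding Reg using req r by simp
  show "1/4 \<le> Re g" if "dist z c < r"
  proof -
    have "norm q \<le> r + norm w" using norm_triangle_ineq[of "of_real r" w] r by (simp add: q_def)
    also have "\<dots> \<le> 2 * r" using that nw by simp
    finally have "(norm q)\<^sup>2 \<le> (2*r)\<^sup>2" by (rule power_mono) simp
    also have "\<dots> = 4 * (r * r)" by (simp add: power2_eq_square)
    also have "\<dots> \<le> 4 * (r * Re q)" using req r by simp
    finally show ?thesis unfolding Reg using qpos by (simp add: field_simps)
  qed
  show "norm g * dist z c \<le> r"
    unfolding g nw[symmetric] using wq qpos r by (simp add: norm_divide field_simps mult_left_mono)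
qed

lemma dist_cis_le: "dist (cis s) (cis t) \<le> dist s t"
proof -
  have "cis s - cis t = cis t * (exp (\<i> * of_real (s - t)) - 1)"
    by (simp add: cis_conv_exp algebra_simps flip: exp_add)
  then have "norm (cis s - cis t) = 2 * \<bar>sin ((s - t)/2)\<bar>"
    by (simp only: norm_mult norm_cis dist_exp_i_1 mult_1)
  also have "\<dots> \<le> 2 * \<bar>(s-t)/2\<bar>" using abs_sin_x_le_abs_x[of "(s - t)/2"] by linarith
  finally show ?thesis by (simp add: dist_norm)
qed

lemma compact_cis_vimage:
  assumes "closed K"
  shows "compact {t \<in> {a..b}. cis t \<in> K}"
proof -
  have "closed (cis -` K)"
    by (intro continuous_closed_vimage assms continuous_intros)
  then have "compact ({a..b} \<inter> cis -` K)" by (intro compact_Int_closed) auto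
  moreover have "{a..b} \<inter> cis -` K = {t \<in> {a..b}. cis t \<in> K}" by auto
  ultimately show ?thesis by simp
qed

lemma norm_1_cis_ex:
  assumes "norm z = 1"
  obtains t where "t \<in> {0..2*pi}" "z = cis t"
proof (rule that[of "Arg2pi z"])
  show "Arg2pi z \<in> {0..2*pi}" using Arg2pi_ge_0 Arg2pi_lt_2pi by (simp add: less_imp_le)
  show "z = cis (Arg2pi z)" using Arg2pi_eq[of z] assms by (simp add: cis_conv_exp)
qed

text \<open>One finite cover, one peak term for each centre. As \<open>cis\<close> is 1-Lipschitz, a
  cover of the angles is a cover of \<open>K\<close>. The last bound, proportional to
  \<open>e\<close>, makes a series of such functions converge uniformly away from
  \<open>K\<close>.\<close>

lemma exists_peak_sum:
  assumes K: "closed K" "K \<subseteq> sphere 0 1" and null: "{t \<in> {0..2*pi}. cis t \<in> K} \<in> null_sets lborel"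
    and e: "0 < e"
  obtains F where "F holomorphic_on ball 0 1" "continuous_on (cball 0 1) F"
    "\<And>z. z \<in> cball 0 1 \<Longrightarrow> 0 \<le> Re (F z)" "\<And>z. z \<in> K \<Longrightarrow> 1/4 \<le> Re (F z)"
    "\<And>z d. z \<in> cball 0 1 \<Longrightarrow> 0 < d \<Longrightarrow> (\<And>k. k \<in> K \<Longrightarrow> d \<le> dist z k) \<Longrightarrow> norm (F z) \<le> e / d"
proof -
  define N where "N = {t \<in> {0..2*pi}. cis t \<in> K}"
  obtain C r where C: "finite C" "C \<subseteq> N" "\<And>c. c \<in> C \<Longrightarrow> 0 < r c"
    "N \<subseteq> (\<Union>c\<in>C. ball c (r c))" "(\<Sum>c\<in>C. r c) < e"
    using compact_null_set_cover[OF compact_cis_vimage[OF K(1)] null e] unfolding N_def by blast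
  define g where "g = (\<lambda>c z. of_real (r c) / (1 + of_real (r c) - z * cnj (cis c)))"
  define F where "F = (\<lambda>z. \<Sum>c\<in>C. g c z)"
  note pt = peak_term[OF norm_cis _ C(3)]
  have Re_nonneg: "0 \<le> Re (g c z)" if "c \<in> C" "z \<in> cball 0 1" for c z
    using pt(2) that unfolding g_def by simp
  show thesis
  proof (rule that[of F])
    show "F holomorphic_on ball 0 1"
      unfolding F_def g_def using pt(1) by (intro holomorphic_intros) (auto simp: less_imp_le)
    show "continuous_on (cball 0 1) F"
      unfolding F_def g_def using pt(1) by (intro continuous_intros) auto
    show "0 \<le> Re (F z)" if "z \<in> cball 0 1" for z
      unfolding F_def Re_sum using Re_nonneg that by (intro sum_nonneg) auto
    show "1/4 \<le> Re (F z)" if "z \<in> K" for z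
    proof -
      have nz: "norm z = 1" using that K by auto
      then obtain t where t: "t \<in> {0..2*pi}" "z = cis t" using norm_1_cis_ex by blast
      then have "t \<in> N" using that by (simp add: N_def)
      then obtain c where c: "c \<in> C" "dist t c < r c" using C(4) by (force simp: dist_commute)
      then have "dist z (cis c) < r c" using dist_cis_le[of t c] t by simp
      then have "1/4 \<le> Re (g c z)" using pt(3) c nz unfolding g_def by simp
      also have "\<dots> \<le> (\<Sum>c\<in>C. Re (g c z))"
        using C(1) c Re_nonneg nz by (intro member_le_sum) auto
      finally show ?thesis by (simp add: F_def)
    qed
    show "norm (F z) \<le> e / d"
      if z: "z \<in> cball 0 1" and d: "0 < d" and dk: "\<And>k. k \<in> K \<Longrightarrow> d \<le> dist z k" for z d
    proof -
      have "norm (g c z) \<le> r c / d" if "c \<in> C" for c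
      proof -
        have "cis c \<in> K" using that C(2) N_def by auto
        then have "norm (g c z) * d \<le> norm (g c z) * dist z (cis c)"
          using dk by (intro mult_left_mono) auto
        also have "\<dots> \<le> r c" using pt(4) that z unfolding g_def by simp
        finally show ?thesis using d by (simp add: field_simps)
      qed
      then have "norm (F z) \<le> (\<Sum>c\<in>C. r c / d)"
        unfolding F_def by (rule sum_norm_le)
      also have "\<dots> \<le> e / d" using C(5) d by (simp add: divide_right_mono less_imp_le flip: sum_divide_distrib)
      finally show ?thesis .
    qed
  qed
qed

lemma disk_algebra_zero_set_null:
  assumes K: "closed K" "K \<subseteq> sphere 0 1" and null: "{t \<in> {0..2*pi}. cis t \<in> K} \<in> null_sets lborel"
  obtains f where "f \<in> disk_algebra" "\<And>z. f z = 0 \<longleftrightarrow> z \<in> K"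
proof -
  have "\<exists>F. F holomorphic_on ball 0 1 \<and> continuous_on (cball 0 1) F \<and>
    (\<forall>z \<in> cball 0 1. 0 \<le> Re (F z)) \<and> (\<forall>z \<in> K. 1/4 \<le> Re (F z)) \<and>
    (\<forall>z \<in> cball 0 1. \<forall>d>0. (\<forall>k \<in> K. d \<le> dist z k) \<longrightarrow> norm (F z) \<le> (1/2)^n / d)" for n :: nat
  proof -
    have "0 < (1/2::real)^n" by simp
    from exists_peak_sum[OF K null this] show ?thesis by metis
  qed
  then obtain F :: "nat \<Rightarrow> complex \<Rightarrow> complex" where hol: "\<And>n. F n holomorphic_on ball 0 1"
    and cont: "\<And>n. continuous_on (cball 0 1) (F n)"
    and nonneg: "\<And>n z. z \<in> cball 0 1 \<Longrightarrow> 0 \<le> Re (F n z)"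
    and ge: "\<And>n z. z \<in> K \<Longrightarrow> 1/4 \<le> Re (F n z)"
    and bound: "\<And>n z d. z \<in> cball 0 1 \<Longrightarrow> 0 < d \<Longrightarrow> (\<And>k. k \<in> K \<Longrightarrow> d \<le> dist z k) \<Longrightarrow> norm (F n z) \<le> (1/2)^n / d"
    by metis
  define S where "S = (\<lambda>z. \<Sum>n. F n z)"
  \<comment> \<open>Since \<open>exp\<close> never vanishes, the zero set is exactly
    \<open>K\<close> in the whole plane, whatever value \<open>S\<close> takes where the series
    diverges.\<close>
  define f where "f = (\<lambda>z. if z \<in> K then 0 else exp (- S z))"
  have unif: "uniform_limit Y (\<lambda>n z. \<Sum>i<n. F i z) S sequentially"
    if "Y \<subseteq> cball 0 1" "0 < d" "\<And>z k. z \<in> Y \<Longrightarrow> k \<in> K \<Longrightarrow> d \<le> dist z k" for Y d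
    unfolding S_def
  proof (rule Weierstrass_m_test)
    show "norm (F n z) \<le> (1/2)^n / d" if "z \<in> Y" for n z
      by (rule bound) (use that \<open>Y \<subseteq> cball 0 1\<close> \<open>0 < d\<close> \<open>\<And>z k. z \<in> Y \<Longrightarrow> k \<in> K \<Longrightarrow> d \<le> dist z k\<close> in auto)
    show "summable (\<lambda>n. (1/2)^n / d)"
      by (intro summable_divide summable_geometric) simp
  qed
  \<comment> \<open>Halving a radius that avoids \<open>K\<close> lets one \<open>d\<close> serve
    both as radius of a neighbourhood and as its distance from \<open>K\<close>.\<close>
  have away: "\<exists>d>0. \<forall>w \<in> cball z d. \<forall>k \<in> K. d \<le> dist w k" if z: "z \<notin> K" for z
  proof -
    have "open (- K)" using K by auto
    then obtain e where e: "e > 0" "cball z e \<subseteq> - K" using z open_contains_cball[of "- K"] by blast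
    have "e / 2 \<le> dist w k" if "w \<in> cball z (e/2)" "k \<in> K" for w k
    proof -
      have "e < dist z k" using e that by (meson ComplD mem_cball not_le subsetD)
      then show ?thesis using that dist_triangle[of z k w] by simp
    qed
    then show ?thesis using e by (intro exI[of _ "e/2"]) auto
  qed
  have hS: "S holomorphic_on ball 0 1"
  proof (rule holomorphic_uniform_sequence[of _ "\<lambda>n z. \<Sum>i<n. F i z"])
    show "(\<lambda>z. \<Sum>i<n. F i z) holomorphic_on ball 0 1" for n
      by (intro holomorphic_intros hol)
    fix z :: complex assume z: "z \<in> ball 0 1"
    then have "z \<notin> K" using K by auto
    then obtain d where d: "d > 0" "\<forall>w \<in> cball z d. \<forall>k \<in> K. d \<le> dist w k" using away by blast
    obtain e where e: "e > 0" "cball z e \<subseteq> ball 0 1" using z open_contains_cball[of "ball (0::complex) 1"] by blast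
    have sub: "cball z (min d e) \<subseteq> cball z d" "cball z (min d e) \<subseteq> cball z e" by auto
    have "uniform_limit (cball z (min d e)) (\<lambda>n z. \<Sum>i<n. F i z) S sequentially"
    proof (rule unif[OF _ d(1)])
      show "cball z (min d e) \<subseteq> cball 0 1" using sub(2) e(2) ball_subset_cball by blast
      show "d \<le> dist w k" if "w \<in> cball z (min d e)" "k \<in> K" for w k
        using that d sub by blast
    qed
    then show "\<exists>d>0. cball z d \<subseteq> ball 0 1 \<and> uniform_limit (cball z d) (\<lambda>n z. \<Sum>i<n. F i z) S sequentially"
      using d e sub by (intro exI[of _ "min d e"]) auto
  qed simp
  have "f holomorphic_on ball 0 1"
  proof (rule holomorphic_transform[of "\<lambda>z. exp (- S z)"])
    show "(\<lambda>z. exp (- S z)) holomorphic_on ball 0 1" by (intro holomorphic_intros hS)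
  qed (use K in \<open>auto simp: f_def\<close>)
  moreover have "continuous (at z within cball 0 1) f" if z: "z \<in> cball 0 1" for z
  proof (cases "z \<in> K")
    case False
    then obtain d where d: "d > 0" "\<forall>w \<in> cball z d. \<forall>k \<in> K. d \<le> dist w k" using away by blast
    have "uniform_limit (cball 0 1 \<inter> cball z d) (\<lambda>n z. \<Sum>i<n. F i z) S sequentially"
      by (rule unif[OF _ d(1)]) (use d in auto)
    then have "continuous_on (cball 0 1 \<inter> cball z d) S"
      by (rule uniform_limit_theorem[rotated])
        (auto intro!: always_eventually continuous_on_sum intro: continuous_on_subset[OF cont])
    then have "continuous_on (cball 0 1 \<inter> ball z d) (\<lambda>w. exp (- S w))"
      by (intro continuous_intros) (auto elim: continuous_on_subset)
    moreover have "w \<notin> K" if "w \<in> ball z d" for w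
      using d that by (metis ball_subset_cball dist_self linorder_not_le subsetD)
    ultimately have "continuous_on (cball 0 1 \<inter> ball z d) f"
      by (subst continuous_on_cong[OF refl, of _ f "\<lambda>w. exp (- S w)"]) (auto simp: f_def)
    then have "continuous (at z within cball 0 1 \<inter> ball z d) f"
      using z d by (simp add: continuous_on_eq_continuous_within)
    moreover have "at z within cball 0 1 \<inter> ball z d = at z within cball 0 1"
      using d by (intro at_within_nhd[of z "ball z d"]) auto
    ultimately show ?thesis by simp
  next
    case True
    have "eventually (\<lambda>w. dist (f w) 0 < e) (at z within cball 0 1)" if "0 < e" for e
    proof -
      \<comment> \<open>At \<open>z\<close> in \<open>K\<close> the first \<open>N\<close> terms
        contribute at least \<open>N/4\<close> to the real part, hence by continuity at least
        \<open>N/8\<close> nearby. The remaining terms have nonnegative real part, so the same bound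
        holds for \<open>S\<close> off \<open>K\<close>.\<close>
      obtain N :: nat where N: "- ln e < real N / 8" using reals_Archimedean2[of "8 * - ln e"] by (auto simp: mult.commute)
      \<comment> \<open>For \<open>N = 0\<close> the strict inequality fails, but the weak one
        needed nearby is trivial.\<close>
      have "real N / 8 < Re (\<Sum>i<N. F i z) \<or> N = 0"
      proof (cases "N = 0")
        case False
        have "(\<Sum>i<N. 1/4) \<le> (\<Sum>i<N. Re (F i z))" by (intro sum_mono ge True)
        with False show ?thesis by (simp add: field_simps)
      qed simp
      moreover have "((\<lambda>w. Re (\<Sum>i<N. F i w)) \<longlongrightarrow> Re (\<Sum>i<N. F i z)) (at z within cball 0 1)"
        using cont z by (intro tendsto_intros) (auto simp: continuous_on_def)
      ultimately have "eventually (\<lambda>w. real N / 8 \<le> Re (\<Sum>i<N. F i w)) (at z within cball 0 1)"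
        by (auto simp del: Re_sum elim!: eventually_mono dest!: order_tendstoD(1)[where a = "real N / 8"])
      moreover have "eventually (\<lambda>w. w \<in> cball 0 1) (at z within cball 0 1)"
        by (simp add: eventually_at_filter)
      ultimately show ?thesis
      proof eventually_elim
        case (elim w)
        show ?case
        proof (cases "w \<in> K")
          case False
          then obtain d where d: "d > 0" "\<forall>w \<in> cball w d. \<forall>k \<in> K. d \<le> dist w k" using away by blast
          have "summable (\<lambda>n. F n w)"
          proof (rule summable_comparison_test)
            show "\<exists>N. \<forall>n\<ge>N. norm (F n w) \<le> (1/2)^n / d"
              using bound[OF elim(2) d(1)] d by auto
            show "summable (\<lambda>n. (1/2)^n / d)"
              by (intro summable_divide summable_geometric) simp
          qed
          then have "Re (S w) = (\<Sum>n. Re (F n w))" "summable (\<lambda>n. Re (F n w))"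
            by (auto simp: S_def Re_suminf summable_Re)
          then have "Re (\<Sum>i<N. F i w) \<le> Re (S w)"
            using nonneg elim(2) by (simp add: sum_le_suminf)
          then have "- ln e < Re (S w)" using elim(1) N by linarith
          then have "exp (- Re (S w)) < e" using \<open>0 < e\<close> by (metis exp_less_cancel_iff exp_ln minus_less_iff)
          then show ?thesis using False by (simp add: f_def)
        qed (use \<open>0 < e\<close> in \<open>simp add: f_def\<close>)
      qed
    qed
    then have "(f \<longlongrightarrow> 0) (at z within cball 0 1)" by (rule tendstoI)
    then show ?thesis using True by (simp add: continuous_within f_def)
  qed
  ultimately have "f \<in> disk_algebra"
    by (simp add: disk_algebra_def continuous_on_eq_continuous_within)
  then show thesis by (rule that) (simp add: f_def)
qed

section \<open>Real trigonometric polynomials\<close>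

text \<open>These are the real trigonometric polynomials, written with a holomorphic
  \<open>p\<close> so that \<open>exp (- poly p z)\<close> can multiply a disk algebra function.
  Restricting to the circle makes them closed under products.\<close>

definition re_poly_on_circle :: "(complex \<Rightarrow> real) \<Rightarrow> bool" where
  "re_poly_on_circle u \<longleftrightarrow> (\<exists>p. \<forall>z \<in> sphere 0 1. u z = Re (poly p z))"

lemma re_poly_on_circle_sum:
  assumes "\<And>i. i \<in> I \<Longrightarrow> re_poly_on_circle (u i)"
  shows "re_poly_on_circle (\<lambda>z. \<Sum>i\<in>I. u i z)"
proof -
  obtain p where p: "\<And>i z. i \<in> I \<Longrightarrow> z \<in> sphere 0 1 \<Longrightarrow> u i z = Re (poly (p i) z)"
    using assms unfolding re_poly_on_circle_def by metis
  show ?thesis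
    unfolding re_poly_on_circle_def by (rule exI[of _ "\<Sum>i\<in>I. p i"]) (simp add: p poly_sum)
qed

lemma re_poly_on_circle_add:
  assumes "re_poly_on_circle u" "re_poly_on_circle v"
  shows "re_poly_on_circle (\<lambda>z. u z + v z)"
proof -
  obtain p q where "\<forall>z \<in> sphere 0 1. u z = Re (poly p z)" "\<forall>z \<in> sphere 0 1. v z = Re (poly q z)"
    using assms unfolding re_poly_on_circle_def by metis
  then show ?thesis
    unfolding re_poly_on_circle_def by (intro exI[of _ "p + q"]) simp
qed

lemma re_poly_on_circle_poly: "re_poly_on_circle (\<lambda>z. Re (poly p z))"
  unfolding re_poly_on_circle_def by blast

text \<open>On the circle \<open>cnj z = 1 / z\<close>, and \<open>Re (c / z ^ k) = Re (cnj c * z ^ k)\<close>.\<close>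

lemma re_poly_on_circle_monom_cnj: "re_poly_on_circle (\<lambda>z. Re (c * z ^ i * cnj (z ^ j)))"
proof (cases "j \<le> i")
  case True
  have "c * z ^ i * cnj (z ^ j) = poly (monom c (i - j)) z" if "norm z = 1" for z
  proof -
    have "z ^ i = z ^ (i - j) * z ^ j" using True by (simp flip: power_add)
    moreover have "z ^ j * cnj (z ^ j) = 1"
      using that unfolding complex_norm_square[symmetric] by (simp add: norm_power)
    ultimately show ?thesis by (simp add: poly_monom)
  qed
  then show ?thesis unfolding re_poly_on_circle_def by (intro exI[of _ "monom c (i - j)"]) simp
next
  case False
  have cnj_eq: "cnj (c * z ^ i * cnj (z ^ j)) = poly (monom (cnj c) (j - i)) z" if "norm z = 1" for z
  proof -
    have "z ^ j = z ^ (j - i) * z ^ i" using False by (simp flip: power_add)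
    moreover have "z ^ i * cnj (z ^ i) = 1"
      using that unfolding complex_norm_square[symmetric] by (simp add: norm_power)
    ultimately show ?thesis by (simp add: poly_monom mult.commute)
  qed
  have "Re (c * z ^ i * cnj (z ^ j)) = Re (poly (monom (cnj c) (j - i)) z)" if "norm z = 1" for z
    using arg_cong[OF cnj_eq[OF that], of Re] by (simp only: cnj.sel)
  then show ?thesis unfolding re_poly_on_circle_def by (intro exI[of _ "monom (cnj c) (j - i)"]) simp
qed

text \<open>\<open>Re a * Re b = Re (a * b) / 2 + Re (a * cnj b) / 2\<close>. The first term is
  again the real part of a polynomial; the second expands into the mixed monomials treated
  above.\<close>

lemma re_poly_on_circle_mult:
  assumes "re_poly_on_circle u" "re_poly_on_circle v"
  shows "re_poly_on_circle (\<lambda>z. u z * v z)"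
proof -
  obtain p q where pq: "\<forall>z \<in> sphere 0 1. u z = Re (poly p z)" "\<forall>z \<in> sphere 0 1. v z = Re (poly q z)"
    using assms unfolding re_poly_on_circle_def by metis
  define w where "w = (\<lambda>z. Re (poly (smult (1/2) (p * q)) z) +
    (\<Sum>i\<le>degree p. \<Sum>j\<le>degree q. Re (coeff p i * cnj (coeff q j) / 2 * z ^ i * cnj (z ^ j))))"
  have "re_poly_on_circle w"
    unfolding w_def
    by (intro re_poly_on_circle_add re_poly_on_circle_poly re_poly_on_circle_sum re_poly_on_circle_monom_cnj)
  moreover have "u z * v z = w z" if "z \<in> sphere 0 1" for z
  proof -
    have "(\<Sum>i\<le>degree p. \<Sum>j\<le>degree q. coeff p i * cnj (coeff q j) / 2 * z ^ i * cnj (z ^ j)) =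
      (\<Sum>i\<le>degree p. \<Sum>j\<le>degree q. (coeff p i * z ^ i) * cnj (coeff q j * z ^ j)) / 2"
      by (simp add: sum_divide_distrib mult_ac)
    also have "\<dots> = poly p z * cnj (poly q z) / 2"
      by (simp add: poly_altdef sum_product)
    finally have "w z = Re (poly p z * poly q z / 2) + Re (poly p z * cnj (poly q z) / 2)"
      unfolding w_def Re_sum[symmetric] by (simp only: poly_smult poly_mult) simp
    also have "\<dots> = u z * v z"
      using pq that by (simp add: field_simps)
    finally show ?thesis by simp
  qed
  ultimately show ?thesis unfolding re_poly_on_circle_def by metis
qed

text \<open>This turns Stone-Weierstrass approximation by polynomials in \<open>Re z\<close> and
  \<open>Im z\<close> into approximation by real parts of holomorphic polynomials.\<close>

lemma re_poly_on_circle_real_polynomial_function: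
  fixes u :: "complex \<Rightarrow> real"
  assumes "real_polynomial_function u"
  shows "re_poly_on_circle u"
  using assms
proof induction
  case (linear u)
  interpret bounded_linear u by fact
  have "u z = Re (poly [:0, of_real (u 1) - \<i> * of_real (u \<i>):] z)" for z
  proof -
    have "z = Re z *\<^sub>R 1 + Im z *\<^sub>R \<i>" by (simp add: complex_eq_iff)
    then have "u z = u (Re z *\<^sub>R 1 + Im z *\<^sub>R \<i>)" by simp
    also have "\<dots> = Re z * u 1 + Im z * u \<i>" by (simp only: add scaleR real_scaleR_def)
    finally show ?thesis by simp
  qed
  then show ?case unfolding re_poly_on_circle_def by blast
next
  case (const c)
  then show ?case unfolding re_poly_on_circle_def by (intro exI[of _ "[:of_real c:]"]) simp
qed (auto intro: re_poly_on_circle_add re_poly_on_circle_mult)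

section \<open>Circle means and boundary uniqueness\<close>

text \<open>Monomials of positive degree have a \<open>2 * pi\<close>-periodic antiderivative in
  \<open>t\<close>, so only the constant coefficient survives.\<close>

lemma has_integral_poly_cis:
  "((\<lambda>t. poly p (cis t)) has_integral 2 * pi * poly p 0) {0..2*pi}"
proof -
  have mono: "((\<lambda>t. coeff p i * cis t ^ i) has_integral (if i = 0 then 2 * pi * poly p 0 else 0)) {0..2*pi}" for i
  proof (cases "i = 0")
    case True
    then show ?thesis using has_integral_const_real[of "poly p 0" 0 "2*pi"]
      by (simp add: poly_0_coeff_0 scaleR_conv_of_real)
  next
    case False
    define G where "G = (\<lambda>t. coeff p i / (\<i> * of_nat i) * exp (\<i> * of_nat i * of_real t))"
    have "((\<lambda>t. coeff p i * cis t ^ i) has_integral G (2*pi) - G 0) {0..2*pi}"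
    proof (rule fundamental_theorem_of_calculus)
      fix t assume "t \<in> {0..2*pi}"
      have "((\<lambda>z. coeff p i / (\<i> * of_nat i) * exp (\<i> * of_nat i * z)) has_field_derivative
          coeff p i * exp (\<i> * of_nat i * of_real t)) (at (of_real t))"
        using False by (auto intro!: derivative_eq_intros)
      then have "(G has_vector_derivative coeff p i * exp (\<i> * of_nat i * of_real t)) (at t within {0..2*pi})"
        unfolding G_def by (rule has_vector_derivative_real_field)
      moreover have "exp (\<i> * of_nat i * of_real t) = cis t ^ i"
        by (simp add: cis_conv_exp flip: exp_of_nat_mult) (simp add: mult_ac)
      ultimately show "(G has_vector_derivative coeff p i * cis t ^ i) (at t within {0..2*pi})" by simp
    qed simp
    moreover have "exp (\<i> * of_nat i * of_real (2*pi)) = 1"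
      using exp_integer_2pi[of "of_nat i"] by (simp add: mult_ac)
    then have "G (2*pi) = G 0" by (simp only: G_def) simp
    ultimately show ?thesis using False by simp
  qed
  have "((\<lambda>t. \<Sum>i\<le>degree p. coeff p i * cis t ^ i) has_integral
     (\<Sum>i\<le>degree p. if i = 0 then 2 * pi * poly p 0 else 0)) {0..2*pi}"
    by (intro has_integral_sum mono) auto
  then show ?thesis by (simp add: poly_altdef)
qed

text \<open>A substitute for Jensen's inequality: if \<open>u\<close> is uniformly close to \<open>Re P\<close> on the circle,
  the maximum principle applies to \<open>f * exp (- P)\<close>, and the mean of \<open>Re P\<close> is its value at \<open>0\<close>.\<close>

lemma ln_norm_at_0_le_circle_mean:
  assumes f: "f \<in> disk_algebra" and u: "continuous_on (sphere 0 1) u"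
    and le: "\<And>z. z \<in> sphere 0 1 \<Longrightarrow> norm (f z) \<le> exp (u z)" and f0: "f 0 \<noteq> 0"
  shows "2 * pi * ln (norm (f 0)) \<le> integral {0..2*pi} (\<lambda>t. u (cis t))"
proof (rule field_le_epsilon)
  fix e :: real assume "0 < e"
  \<comment> \<open>The approximation error enters twice, in the maximum principle and in replacing
    \<open>g\<close> by \<open>u\<close> under the integral, each time with weight
    \<open>2 * pi\<close>.\<close>
  define d where "d = e / (4 * pi)"
  have d: "d > 0" using \<open>0 < e\<close> by (simp add: d_def)
  obtain g where g: "real_polynomial_function g" "\<And>z. z \<in> sphere 0 1 \<Longrightarrow> \<bar>u z - g z\<bar> < d"
    using Stone_Weierstrass_real_polynomial_function[OF compact_sphere u d] by blast
  obtain p where p: "\<And>z. z \<in> sphere 0 1 \<Longrightarrow> g z = Re (poly p z)"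
    using re_poly_on_circle_real_polynomial_function[OF g(1)] unfolding re_poly_on_circle_def by blast
  have "norm (f 0 * exp (- poly p 0)) \<le> exp d"
  proof (rule maximum_modulus_frontier[of "\<lambda>z. f z * exp (- poly p z)" "ball 0 1"])
    show "(\<lambda>z. f z * exp (- poly p z)) holomorphic_on interior (ball 0 1)"
      using f by (auto simp: disk_algebra_def intro!: holomorphic_intros)
    show "continuous_on (closure (ball 0 1)) (\<lambda>z. f z * exp (- poly p z))"
      using f by (auto simp: disk_algebra_def intro!: continuous_intros)
    show "norm (f z * exp (- poly p z)) \<le> exp d" if "z \<in> frontier (ball 0 1)" for z
    proof -
      have z: "z \<in> sphere 0 1" using that by simp
      have "norm (f z * exp (- poly p z)) \<le> exp (u z) * exp (- g z)"
        unfolding norm_mult norm_exp_eq_Re using le[OF z] p[OF z] by simp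
      also have "\<dots> \<le> exp d" using g(2)[OF z] by (simp flip: exp_add)
      finally show ?thesis .
    qed
  qed auto
  then have "ln (norm (f 0) * exp (- Re (poly p 0))) \<le> ln (exp d)"
    unfolding norm_mult norm_exp_eq_Re using f0 by (subst ln_le_cancel_iff) auto
  then have "ln (norm (f 0)) - Re (poly p 0) \<le> d"
    using f0 by (simp add: ln_mult)
  have int: "((\<lambda>t. g (cis t)) has_integral 2 * pi * Re (poly p 0)) {0..2*pi}"
    using has_integral_linear[OF has_integral_poly_cis[of p] bounded_linear_Re]
    by (simp add: o_def p mult.assoc)
  have "(\<lambda>t. u (cis t)) integrable_on {0..2*pi}"
    by (intro integrable_continuous_real continuous_on_compose2[OF u] continuous_intros) auto
  then have "2 * pi * Re (poly p 0) \<le> integral {0..2*pi} (\<lambda>t. u (cis t) + d)"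
    using g(2) by (intro has_integral_le[OF int integrable_integral])
      (auto intro!: integrable_add simp: abs_less_iff, smt (verit) norm_cis)
  also have "\<dots> = integral {0..2*pi} (\<lambda>t. u (cis t)) + 2 * pi * d"
    using \<open>(\<lambda>t. u (cis t)) integrable_on {0..2*pi}\<close> by (subst integral_add) auto
  finally have "2 * pi * Re (poly p 0) \<le> integral {0..2*pi} (\<lambda>t. u (cis t)) + 2 * pi * d" .
  moreover have "2 * pi * ln (norm (f 0)) \<le> 2 * pi * (Re (poly p 0) + d)"
    using \<open>ln (norm (f 0)) - Re (poly p 0) \<le> d\<close> by (intro mult_left_mono) auto
  moreover have "4 * pi * d = e" by (simp add: d_def)
  ultimately show "2 * pi * ln (norm (f 0)) \<le> integral {0..2*pi} (\<lambda>t. u (cis t)) + e"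
    by (simp add: algebra_simps)
qed

text \<open>Truncating \<open>ln (norm (f z))\<close> below at \<open>- s\<close> gives a continuous
  majorant \<open>u\<close>. It equals \<open>- s\<close> on the boundary zeros, so its mean tends
  to minus infinity with growing \<open>s\<close>, while \<open>ln (norm (f 0))\<close> would stay
  fixed.\<close>

lemma disk_algebra_eq_0_at_0:
  assumes f: "f \<in> disk_algebra" and m: "0 < measure lborel {t \<in> {0..2*pi}. f (cis t) = 0}"
  shows "f 0 = 0"
proof (rule ccontr)
  assume f0: "f 0 \<noteq> 0"
  define N where "N = {t \<in> {0..2*pi}. f (cis t) = 0}"
  have cont: "continuous_on (cball 0 1) f" using f by (simp add: disk_algebra_def)
  obtain B where B: "\<And>z. z \<in> cball 0 1 \<Longrightarrow> norm (f z) \<le> B"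
    using compact_imp_bounded[OF compact_continuous_image[OF cont compact_cball]]
    unfolding bounded_iff by blast
  \<comment> \<open>\<open>M \<ge> 1\<close> gives \<open>- s \<le> ln M - s\<close> on the zeros
    and \<open>exp (- s) \<le> M\<close> off them.\<close>
  define M where "M = max B 1"
  have M: "1 \<le> M" "\<And>z. z \<in> cball 0 1 \<Longrightarrow> norm (f z) \<le> M"
    using B by (auto simp: M_def max.coboundedI1)
  have "continuous_on {0..2*pi} (\<lambda>t. f (cis t))"
    by (intro continuous_on_compose2[OF cont] continuous_intros) auto
  from continuous_closed_preimage_constant[OF this, of 0]
  have "closed N" by (simp add: N_def)
  then have N: "N \<in> sets borel" by auto
  have "emeasure lborel N \<le> emeasure lborel {0..2*pi}" by (rule emeasure_mono) (auto simp: N_def)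
  then have "N \<in> lmeasurable"
    using N by (auto simp: fmeasurable_def top.not_eq_extremum intro!: sets_completionI_sets elim: le_less_trans)
  then have "((\<lambda>t. 1) has_integral measure lborel N) N"
    using N by (intro has_integral_measure_lborel) (auto simp: fmeasurable_def)
  moreover have "N \<subseteq> {0..2*pi}" by (auto simp: N_def)
  ultimately have iN: "(indicator N has_integral measure lborel N) {0..2*pi}"
    using has_integral_restrict[of N "{0..2*pi}" "\<lambda>t. 1::real" "measure lborel N"]
    by (simp add: indicator_def[abs_def] of_bool_def)
  have key: "2 * pi * ln (norm (f 0)) \<le> 2 * pi * ln M - measure lborel N * s" if s: "0 \<le> s" for s
  proof -
    define u where "u = (\<lambda>z. ln (max (norm (f z)) (exp (- s))))"
    have pos: "0 < max (norm (f z)) (exp (- s))" for z by (simp add: less_max_iff_disj)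
    have contu: "continuous_on (sphere 0 1) u"
      unfolding u_def using pos
      by (intro continuous_intros continuous_on_subset[OF cont]) (auto simp: less_le)
    have "2 * pi * ln (norm (f 0)) \<le> integral {0..2*pi} (\<lambda>t. u (cis t))"
    proof (rule ln_norm_at_0_le_circle_mean[OF f contu _ f0])
      show "norm (f z) \<le> exp (u z)" for z using pos by (simp add: u_def)
    qed
    also have "\<dots> \<le> 2 * pi * ln M - measure lborel N * s"
    proof (rule has_integral_le)
      show "((\<lambda>t. u (cis t)) has_integral integral {0..2*pi} (\<lambda>t. u (cis t))) {0..2*pi}"
        by (intro integrable_integral integrable_continuous_real continuous_on_compose2[OF contu] continuous_intros) auto
      show "((\<lambda>t. ln M - indicator N t * s) has_integral 2 * pi * ln M - measure lborel N * s) {0..2*pi}"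
        using has_integral_const_real[of "ln M" 0 "2*pi"]
        by (intro has_integral_diff has_integral_mult_left iN) simp
      show "u (cis t) \<le> ln M - indicator N t * s" if "t \<in> {0..2*pi}" for t
      proof (cases "t \<in> N")
        case True
        then show ?thesis using M(1) by (simp add: u_def N_def max_def)
      next
        case False
        have "exp (- s) \<le> M" using s M(1) by (smt (verit) exp_le_one_iff)
        then have "max (norm (f (cis t))) (exp (- s)) \<le> M" using M(2)[of "cis t"] by simp
        then show ?thesis using False pos[of "cis t"] by (simp add: u_def del: max.bounded_iff)
      qed
    qed
    finally show ?thesis .
  qed
  \<comment> \<open>With this \<open>s\<close> the upper bound in \<open>key\<close> is
    \<open>2 * pi * ln (norm (f 0)) - 1\<close>; \<open>norm (f 0) \<le> M\<close> ensures
    \<open>s \<ge> 0\<close>.\<close>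
  define s where "s = (2 * pi * ln M - 2 * pi * ln (norm (f 0)) + 1) / measure lborel N"
  have "measure lborel N > 0" using m by (simp add: N_def)
  moreover have "norm (f 0) \<le> M" using M by simp
  then have "2 * pi * ln (norm (f 0)) \<le> 2 * pi * ln M" using f0 by (intro mult_left_mono) (auto intro: ln_mono)
  ultimately show False using key[of s] by (simp add: s_def)
qed

lemma disk_algebra_eq_0_cball:
  assumes f: "f \<in> disk_algebra" and "\<And>z. z \<in> ball 0 1 \<Longrightarrow> f z = 0" and z: "z \<in> cball 0 1"
  shows "f z = 0"
proof -
  have "closure (ball 0 1) = cball (0::complex) 1" by simp
  then show ?thesis
    using continuous_constant_on_closure[of "ball 0 1" f 0 z] assms by (simp add: disk_algebra_def)
qed

text \<open>A nonconstant \<open>f\<close> has a zero of finite order \<open>n\<close> at 0.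
  Dividing by \<open>z ^ n\<close> stays in the disk algebra and keeps the zeros on the circle, but
  the quotient does not vanish at 0, against the previous result.\<close>

lemma disk_algebra_uniqueness:
  assumes f: "f \<in> disk_algebra" and m: "0 < measure lborel {t \<in> {0..2*pi}. f (cis t) = 0}"
    and z: "z \<in> cball 0 1"
  shows "f z = 0"
proof -
  have cont: "continuous_on (cball 0 1) f" and hol: "f holomorphic_on ball 0 1"
    using f by (auto simp: disk_algebra_def)
  have f0: "f 0 = 0" by (rule disk_algebra_eq_0_at_0[OF f m])
  have "f constant_on ball 0 1"
  proof (rule ccontr)
    assume nc: "\<not> f constant_on ball 0 1"
    obtain g r n where g: "0 < n" "0 < r" "ball 0 r \<subseteq> ball (0::complex) 1" "g holomorphic_on ball 0 r"
            "\<And>w. w \<in> ball 0 r \<Longrightarrow> f w = (w - 0)^n * g w"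
            "\<And>w. w \<in> ball 0 r \<Longrightarrow> g w \<noteq> 0"
      by (rule holomorphic_factor_zero_nonconstant[OF hol open_ball connected_ball _ f0 nc])
        (simp, rule that, assumption+)
    define h where "h = (\<lambda>w. if w \<in> ball 0 r then g w else f w / w ^ n)"
    have h: "h w = f w / w ^ n" if "w \<noteq> 0" for w
      using g(5)[of w] that by (simp add: h_def)
    have h1: "h holomorphic_on ball 0 r"
      using g(4) by (rule holomorphic_transform) (simp add: h_def)
    have h2: "h holomorphic_on ball 0 1 - {0}"
    proof (rule holomorphic_transform[of "\<lambda>w. f w / w ^ n"])
      show "(\<lambda>w. f w / w ^ n) holomorphic_on ball 0 1 - {0}"
        by (intro holomorphic_intros holomorphic_on_subset[OF hol]) auto
    qed (simp add: h)
    have "h holomorphic_on ball 0 r \<union> (ball 0 1 - {0})"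
      by (intro holomorphic_on_Un h1 h2) auto
    then have hh: "h holomorphic_on ball 0 1"
      by (rule holomorphic_on_subset) (use g(2) in auto)
    moreover have "continuous (at w within cball 0 1) h" if w: "w \<in> cball 0 1" for w
    proof (cases "w = 0")
      case True
      then show ?thesis
        using hh holomorphic_on_imp_continuous_on[OF hh] continuous_on_eq_continuous_at[of "ball 0 1" h]
        by (auto intro: continuous_at_imp_continuous_at_within)
    next
      case False
      have "continuous (at w within cball 0 1) (\<lambda>w. f w / w ^ n)"
        using cont w False by (intro continuous_intros) (auto simp: continuous_on_eq_continuous_within)
      then show ?thesis
      proof (rule continuous_transform_within)
        show "f x / x ^ n = h x" if "dist x w < norm w" for x
          using that h[of x] by fastforce
      qed (use False w in auto)
    qed
    ultimately have "h \<in> disk_algebra"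
      by (simp add: disk_algebra_def continuous_on_eq_continuous_within)
    moreover have "{t \<in> {0..2*pi}. h (cis t) = 0} = {t \<in> {0..2*pi}. f (cis t) = 0}"
      by (simp add: h)
    ultimately have "h 0 = 0" using m by (intro disk_algebra_eq_0_at_0) simp_all
    then show False using g by (simp add: h_def)
  qed
  then have "f w = 0" if "w \<in> ball 0 1" for w
    using that f0 unfolding constant_on_def by (metis centre_in_ball zero_less_one)
  then show ?thesis by (rule disk_algebra_eq_0_cball[OF f _ z])
qed

section \<open>Arcs and the circle measure\<close>

lemma open_arc_sphere:
  assumes "open_arc I"
  obtains V where "open V" "I = sphere 0 1 \<inter> V"
proof -
  obtain a b where ab: "a < b" "b \<le> a + 2 * pi" and I: "I = cis ` {a<..<b}"
    using assms by (auto simp: open_arc_def)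
  \<comment> \<open>The removed set is the complementary closed arc, a single point when
    \<open>b = a + 2 * pi\<close>.\<close>
  define V where "V = - cis ` {b..a + 2 * pi}"
  have "compact (cis ` {b..a + 2 * pi})"
    by (intro compact_continuous_image continuous_intros) auto
  then have V: "open V" by (simp add: V_def compact_imp_closed open_Compl)
  have "cis t \<in> V" if t: "t \<in> {a<..<b}" for t
    unfolding V_def Compl_iff
  proof
    assume "cis t \<in> cis ` {b..a + 2 * pi}"
    then obtain s where s: "b \<le> s" "s \<le> a + 2 * pi" "cis t = cis s" by auto
    have "cis (s - t) = cis 0" using s(3) by (simp add: cis_divide[symmetric])
    then have "cos (s - t) = 1" by (simp add: complex_eq_iff)
    then obtain n :: int where n: "s - t = of_int n * 2 * pi" using cos_one_2pi_int by auto
    have "0 < s - t" "s - t < 2 * pi" using s t by auto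
    then have "0 < of_int n * (2 * pi)" "of_int n * (2 * pi) < 1 * (2 * pi)" using n by auto
    then have "0 < n" "n < 1" by (auto simp: zero_less_mult_iff)
    then show False by simp
  qed
  moreover have "z \<in> I" if z: "z \<in> sphere 0 1" "z \<in> V" for z
  proof -
    obtain s where s: "s \<in> {0..2*pi}" "z * cis (- a) = cis s"
      using norm_1_cis_ex[of "z * cis (- a)"] z by (auto simp: norm_mult)
    have "z = z * cis (- a) * cis a" by (simp add: cis_mult mult.assoc)
    also have "\<dots> = cis (a + s)" by (simp only: s(2) cis_mult add.commute)
    finally have z': "z = cis (a + s)" .
    show ?thesis
    proof (cases "a + s < b \<and> 0 < s")
      \<comment> \<open>The endpoint \<open>cis a\<close>, where \<open>s = 0\<close>, appears in
        the complementary arc as \<open>cis (a + 2 * pi)\<close>.\<close>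
      case False
      have "z \<in> cis ` {b..a + 2 * pi}"
      proof (cases "a + s < b")
        case True
        then have "s = 0" using False s by auto
        then have "z = cis (a + 2 * pi)" using z' by (simp add: cis_mult[symmetric])
        then show ?thesis using ab by auto
      qed (use z' s in auto)
      then show ?thesis using z by (simp add: V_def)
    qed (use z' I in auto)
  qed
  ultimately have "I = sphere 0 1 \<inter> V" using I by auto
  with V show thesis by (rule that)
qed

lemma measure_circle_measure:
  assumes "S \<in> sets borel"
  shows "measure circle_measure S = measure lborel {t \<in> {0..2*pi}. cis t \<in> S} / (2 * pi)"
proof -
  have [measurable]: "cis \<in> borel_measurable borel"
    by (intro borel_measurable_continuous_onI continuous_intros)
  have eq: "{0..2*pi} \<inter> cis -` S = {t \<in> {0..2*pi}. cis t \<in> S}" by auto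
  have "cis -` S \<in> sets borel" using measurable_sets_borel[of cis borel S] assms by simp
  then show ?thesis
    unfolding circle_measure_def using assms by (simp add: measure_distr eq)
qed

section \<open>The characterization of t-analytic sets\<close>

theorem theorem4p13:
  fixes E :: "complex set"
  assumes "closed E" and "E \<subseteq> cball 0 1" and "\<exists>x\<in>E. \<exists>y\<in>E. x \<noteq> y"
  shows "t_analytic disk_algebra E \<longleftrightarrow>
    (\<nexists>x. x isolated_in E) \<and>
    (\<forall>I. open_arc I \<and> I \<inter> closure (E \<inter> ball 0 1) = {} \<longrightarrow>
       I \<inter> E = {} \<or> measure circle_measure (I \<inter> E) > 0)"
proof -
  have arc_sets: "{t \<in> {0..2*pi}. cis t \<in> I \<inter> E} \<in> sets lborel \<and> I \<inter> E \<in> sets borel" if I: "open_arc I" for I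
  proof -
    have [measurable]: "cis \<in> borel_measurable borel"
      by (intro borel_measurable_continuous_onI continuous_intros)
    obtain V where "open V" "I = sphere 0 1 \<inter> V" using open_arc_sphere[OF I] .
    then have I: "I \<inter> E \<in> sets borel" using assms(1) by (auto intro!: sets.Int)
    have "{0..2*pi} \<inter> cis -` (I \<inter> E) = {t \<in> {0..2*pi}. cis t \<in> I \<inter> E}" by auto
    moreover have "{0..2*pi} \<inter> cis -` (I \<inter> E) \<in> sets borel"
      using measurable_sets_borel[of cis borel "I \<inter> E"] I by (intro sets.Int) auto
    ultimately show ?thesis using I by simp
  qed
  have finite_meas: "emeasure lborel A < \<infinity>" if "A \<subseteq> {0..2*pi}" for A
  proof -
    have "emeasure lborel A \<le> emeasure lborel {0..2*pi}" by (rule emeasure_mono) (use that in auto)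
    then show ?thesis by (rule le_less_trans) simp
  qed
  show ?thesis
  proof (intro iffI conjI allI impI notI)
    assume T: "t_analytic disk_algebra E" and "\<exists>x. x isolated_in E"
    then obtain x V where x: "x \<in> E" "open V" "V \<inter> E = {x}" by (auto simp: isolated_in_def)
    then have "openin (top_of_set E) {x}" by (metis openin_open inf_commute)
    \<comment> \<open>This function vanishes on the relatively open set \<open>{x}\<close> but not
      at a second point of \<open>E\<close>.\<close>
    moreover have "(\<lambda>z. z - x) \<in> disk_algebra"
      by (auto simp: disk_algebra_def intro!: continuous_intros holomorphic_intros)
    ultimately have "z - x = 0" if "z \<in> E" for z
      using T[unfolded t_analytic_def, rule_format, of "\<lambda>z. z - x" "{x}" z] that by simp
    then show False using assms(3) by (metis eq_iff_diff_eq_0)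
  next
    fix I
    assume T: "t_analytic disk_algebra E"
      and I: "open_arc I \<and> I \<inter> closure (E \<inter> ball 0 1) = {}"
    show "I \<inter> E = {} \<or> 0 < measure circle_measure (I \<inter> E)"
    proof (rule ccontr)
      assume *: "\<not> ?thesis"
      then obtain x where x: "x \<in> I" "x \<in> E" by auto
      from assms(3) obtain y where y: "y \<in> E" "y \<noteq> x" by metis
      obtain V where V: "open V" "I = sphere 0 1 \<inter> V" using open_arc_sphere I by blast
      \<comment> \<open>Near \<open>x\<close> the set \<open>E\<close> then lies on the circle
        inside \<open>I\<close>, and \<open>y\<close> stays outside \<open>K\<close>, so a function
        vanishing exactly on \<open>K\<close> contradicts t-analyticity at \<open>y\<close>.\<close>
      have "open (V - closure (E \<inter> ball 0 1) - {y})" using V by auto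
      moreover have "x \<in> V - closure (E \<inter> ball 0 1) - {y}" using V x y I by auto
      ultimately obtain d where d: "d > 0" "cball x d \<subseteq> V - closure (E \<inter> ball 0 1) - {y}"
        unfolding open_contains_cball by blast
      define K where "K = E \<inter> sphere 0 1 \<inter> cball x d"
      have K: "closed K" "K \<subseteq> sphere 0 1" using assms(1) by (auto simp: K_def intro!: closed_Int)
      have KI: "K \<subseteq> I \<inter> E" using d V by (auto simp: K_def)
      have "measure lborel {t \<in> {0..2*pi}. cis t \<in> I \<inter> E} = 0"
        using * I arc_sets measure_circle_measure[of "I \<inter> E"]
        by (simp add: zero_less_divide_iff not_less antisym)
      \<comment> \<open>\<open>measure\<close> is 0 also on sets of infinite measure; finiteness
        excludes that reading.\<close>
      then have "emeasure lborel {t \<in> {0..2*pi}. cis t \<in> I \<inter> E} = 0"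
        using finite_meas[OF Collect_restrict, of "\<lambda>t. cis t \<in> I \<inter> E"]
        by (metis emeasure_eq_ennreal_measure ennreal_0 infinity_ennreal_def less_irrefl)
      then have "{t \<in> {0..2*pi}. cis t \<in> I \<inter> E} \<in> null_sets lborel"
        by (rule null_setsI) (use arc_sets[OF conjunct1[OF I]] in blast)
      moreover have "{t \<in> {0..2*pi}. cis t \<in> K} \<subseteq> {t \<in> {0..2*pi}. cis t \<in> I \<inter> E}" using KI by auto
      moreover have "{t \<in> {0..2*pi}. cis t \<in> K} \<in> sets lborel"
        using compact_cis_vimage[OF K(1), of 0 "2*pi"] by (simp add: borel_compact)
      ultimately have "{t \<in> {0..2*pi}. cis t \<in> K} \<in> null_sets lborel"
        by (meson null_sets_subset)
      then obtain f where f: "f \<in> disk_algebra" "\<And>z. f z = 0 \<longleftrightarrow> z \<in> K"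
        by (rule disk_algebra_zero_set_null[OF K]) (rule that)
      have "z \<in> K" if z: "z \<in> E \<inter> ball x d" for z
      proof -
        have "z \<in> cball x d" using z by auto
        then have "z \<notin> closure (E \<inter> ball 0 1)" using d by blast
        then have "z \<notin> E \<inter> ball 0 1" by (meson closure_subset subsetD)
        then have "z \<in> sphere 0 1" using z assms(2) by (force simp: subset_iff)
        then show ?thesis using z by (auto simp: K_def)
      qed
      then have "\<forall>z\<in>E \<inter> ball x d. f z = 0" using f by blast
      moreover have "openin (top_of_set E) (E \<inter> ball x d)" by (simp add: openin_open_Int)
      moreover have "E \<inter> ball x d \<noteq> {}" using x d by auto
      ultimately have "f y = 0" using T[unfolded t_analytic_def, rule_format, of f "E \<inter> ball x d" y] f(1) y by simp
      then show False using f d by (auto simp: K_def)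
    qed
  next
    assume R: "(\<nexists>x. x isolated_in E) \<and> (\<forall>I. open_arc I \<and> I \<inter> closure (E \<inter> ball 0 1) = {} \<longrightarrow>
       I \<inter> E = {} \<or> measure circle_measure (I \<inter> E) > 0)"
    show "t_analytic disk_algebra E"
      unfolding t_analytic_def
    proof (intro ballI allI impI)
      fix f U z
      assume f: "f \<in> disk_algebra" and U: "openin (top_of_set E) U \<and> U \<noteq> {} \<and> (\<forall>x\<in>U. f x = 0)"
        and "z \<in> E"
      then have z: "z \<in> cball 0 1" using assms(2) by blast
      obtain V where V: "open V" "U = E \<inter> V" using U by (auto simp: openin_open)
      show "f z = 0"
      proof (cases "U \<inter> ball 0 1 = {}")
        case False
        then obtain x where x: "x \<in> U" "x \<in> ball 0 1" by auto
        \<comment> \<open>Without isolated points, \<open>x\<close> is a limit of zeros of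
          \<open>f\<close> inside the open disk, so the identity theorem applies.\<close>
        have "x islimpt E" using R x V by (auto simp: isolated_in_islimpt_iff)
        moreover have "x \<in> V \<inter> ball 0 1" "open (V \<inter> ball 0 1)" using x V by auto
        ultimately have "x islimpt (E \<inter> (V \<inter> ball 0 1))" by (intro islimpt_Int_eventually eventually_at_in_open')
        then have "x islimpt (U \<inter> ball 0 1)" using V by (simp add: Int_assoc)
        then have "f w = 0" if "w \<in> ball 0 1" for w
          by (rule analytic_continuation[where S = "ball 0 1", rotated 5])
            (use f x U that in \<open>auto simp: disk_algebra_def\<close>)
        then show ?thesis by (rule disk_algebra_eq_0_cball[OF f _ z])
      next
        case True
        obtain x where x: "x \<in> U" using U by auto
        then have "norm x = 1" using True V assms(2) by (force simp: subset_iff)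
        then obtain a where a: "x = cis a" using norm_1_cis_ex by blast
        obtain e where e: "e > 0" "ball x e \<subseteq> V" using V x open_contains_ball by blast
        \<comment> \<open>\<open>d \<le> pi\<close> keeps the parameter interval within length
          \<open>2 * pi\<close>; \<open>d \<le> e\<close> keeps the arc in \<open>V\<close>.\<close>
        define d where "d = min e pi"
        have d: "0 < d" "d \<le> pi" "d \<le> e" using e by (auto simp: d_def)
        define I where "I = cis ` {a - d<..<a + d}"
        have I: "open_arc I" unfolding open_arc_def
          by (rule exI[of _ "a - d"], rule exI[of _ "a + d"]) (use d I_def in auto)
        have IV: "I \<subseteq> V"
        proof
          fix w assume "w \<in> I"
          then obtain t where t: "w = cis t" "dist a t < d" by (auto simp: I_def dist_real_def)
          then have "w \<in> ball x e" using dist_cis_le[of a t] a d by simp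
          then show "w \<in> V" using e by blast
        qed
        \<comment> \<open>An open set disjoint from \<open>E \<inter> ball 0 1\<close> also misses
          its closure, which makes the arc condition available for \<open>I\<close>.\<close>
        have "V \<inter> (E \<inter> ball 0 1) = {}" using True V by blast
        then have "I \<inter> closure (E \<inter> ball 0 1) = {}"
          using IV V(1) open_Int_closure_eq_empty by blast
        moreover have "x \<in> I" using a d by (auto simp: I_def)
        ultimately have "0 < measure circle_measure (I \<inter> E)" using R[THEN conjunct2, rule_format, of I] I x V by auto
        then have "0 < measure lborel {t \<in> {0..2*pi}. cis t \<in> I \<inter> E}"
          using arc_sets[OF I] by (simp add: measure_circle_measure zero_less_divide_iff)
        also have "\<dots> \<le> measure lborel {t \<in> {0..2*pi}. f (cis t) = 0}"
        proof (rule measure_mono_fmeasurable)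
          show "{t \<in> {0..2*pi}. cis t \<in> I \<inter> E} \<subseteq> {t \<in> {0..2*pi}. f (cis t) = 0}"
            using U V IV by auto
          show "{t \<in> {0..2*pi}. cis t \<in> I \<inter> E} \<in> sets lborel" using arc_sets I by blast
          have cont: "continuous_on (cball 0 1) f" using f by (simp add: disk_algebra_def)
          have "continuous_on {0..2*pi} (\<lambda>t. f (cis t))"
            by (intro continuous_on_compose2[OF cont] continuous_intros) auto
          from continuous_closed_preimage_constant[OF this, of 0]
          have "{t \<in> {0..2*pi}. f (cis t) = 0} \<in> sets lborel" by simp
          then show "{t \<in> {0..2*pi}. f (cis t) = 0} \<in> fmeasurable lborel"
            by (rule fmeasurableI) (rule finite_meas[OF Collect_restrict])
        qed
        finally show ?thesis using disk_algebra_uniqueness[OF f _ z] by blast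
      qed
    qed
  qed
qed

end
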